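(* Let $U_{n,m}$ be a uni-cyclic graph (a finite simple connected graph on $n$ vertices containing exactly one cycle, which has length $m\le n$), with edge set $E=\{e_1,e_2,\ldots,e_n\}$ labeled so that $\{e_1,\ldots,e_m\}$ is the edge set of the unique cycle. Then a subset $F\subset E$ belongs to $s(U_{n,m})$ if and only if $F=E\setminus\{e_i\}$ for some $i\in\{1,\ldots,m\}$. In particular, $$s(U_{n,m})=\{\hat E_i \mid 1\le i\le m\},\qquad \hat E_i=E\setminus\{e_i\}.$$
   Context: A spanning tree of a finite simple connected graph $G(V,E)$ is a subtree of $G$ that contains every vertex of $G$. The set $s(G)$ is the collection of all edge sets of spanning trees of $G$: $s(G)=\{E(T)\subset E \mid T \text{ a spanning tree of } G\}$. A uni-cyclic graph $U_{n,m}$ is a finite simple connected graph on $n$ vertices containing exactly one cycle, of length $m$ (with $m\le n$); it has exactly $n$ edges. *)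

theory Defs
  imports Main
begin

datatype 'a graph = Graph (verts: "'a set") (edges: "'a set set")

definition simple_graph :: "'a graph \<Rightarrow> bool" where
  "simple_graph G \<longleftrightarrow> finite (verts G) \<and> (\<forall>x\<in>edges G. x \<subseteq> verts G \<and> card x = 2)"

definition subgraph :: "'a graph \<Rightarrow> 'a graph \<Rightarrow> bool" where
  "subgraph H G \<longleftrightarrow> simple_graph H \<and> verts H \<subseteq> verts G \<and> edges H \<subseteq> edges G"

definition walk :: "'a graph \<Rightarrow> 'a list \<Rightarrow> bool" where
  "walk G p \<longleftrightarrow> p \<noteq> [] \<and> set p \<subseteq> verts G \<and> successively (\<lambda>u v. {u, v} \<in> edges G) p"

definition connected_graph :: "'a graph \<Rightarrow> bool" where
  "connected_graph G \<longleftrightarrow> verts G \<noteq> {} \<and>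
     (\<forall>u\<in>verts G. \<forall>v\<in>verts G. \<exists>p. walk G p \<and> hd p = u \<and> last p = v)"

definition cycle_edges :: "'a list \<Rightarrow> 'a set set" where
  "cycle_edges p = {{p ! i, p ! (Suc i mod length p)} | i. i < length p}"

definition cycle_graph :: "'a graph \<Rightarrow> bool" where
  "cycle_graph C \<longleftrightarrow>
     (\<exists>p. distinct p \<and> length p \<ge> 3 \<and> verts C = set p \<and> edges C = cycle_edges p)"

text \<open>Cycles are counted as subgraphs, so that rotating or reversing the vertex sequence of a
  cycle does not give a new one.  The length of a cycle is its number of edges.\<close>

definition cycles :: "'a graph \<Rightarrow> 'a graph set" where
  "cycles G = {C. subgraph C G \<and> cycle_graph C}"

definition tree :: "'a graph \<Rightarrow> bool" where
  "tree T \<longleftrightarrow> simple_graph T \<and> connected_graph T \<and> cycles T = {}"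

definition spanning_tree :: "'a graph \<Rightarrow> 'a graph \<Rightarrow> bool" where
  "spanning_tree T G \<longleftrightarrow> subgraph T G \<and> tree T \<and> verts T = verts G"

definition spanning_tree_edge_sets :: "'a graph \<Rightarrow> 'a set set set" where
  "spanning_tree_edge_sets G = {edges T | T. spanning_tree T G}"

definition unicyclic :: "'a graph \<Rightarrow> nat \<Rightarrow> nat \<Rightarrow> bool" where
  "unicyclic G n m \<longleftrightarrow> simple_graph G \<and> connected_graph G \<and> card (verts G) = n \<and> m \<le> n \<and>
     (\<exists>C. cycles G = {C} \<and> card (edges C) = m)"

end

theory Submission
  imports Defs
begin

text \<open>Deleting a cycle edge keeps the graph connected, since the rest of the cycle still joins its
  two ends, and it destroys the only cycle.  Conversely, a spanning tree \<open>T\<close> misses some edge \<open>d\<close> of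
  the cycle.  If it missed another edge \<open>f\<close> as well, the path of \<open>T\<close> between the ends of \<open>f\<close> would
  close up with \<open>f\<close> to a cycle avoiding \<open>d\<close>, hence to a second cycle.\<close>

section \<open>Walks and reachability\<close>

definition reachable :: "'a graph \<Rightarrow> 'a \<Rightarrow> 'a \<Rightarrow> bool" where
  "reachable G u v \<longleftrightarrow> (\<exists>p. walk G p \<and> hd p = u \<and> last p = v)"

lemma connected_graph_iff_reachable:
  "connected_graph G \<longleftrightarrow> verts G \<noteq> {} \<and> (\<forall>u\<in>verts G. \<forall>v\<in>verts G. reachable G u v)"
  by (simp add: connected_graph_def reachable_def)

lemma reachable_refl: "u \<in> verts G \<Longrightarrow> reachable G u u"
  unfolding reachable_def walk_def by (intro exI[of _ "[u]"]) auto

lemma reachable_edge: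
  "u \<in> verts G \<Longrightarrow> v \<in> verts G \<Longrightarrow> {u, v} \<in> edges G \<Longrightarrow> reachable G u v"
  unfolding reachable_def walk_def by (intro exI[of _ "[u, v]"]) auto

lemma reachable_sym:
  assumes "reachable G u v"
  shows "reachable G v u"
proof -
  obtain p where p: "walk G p" "hd p = u" "last p = v"
    using assms by (auto simp: reachable_def)
  have "walk G (rev p)"
    using p(1) by (simp add: walk_def insert_commute)
  then show ?thesis
    using p unfolding reachable_def walk_def
    by (intro exI[of _ "rev p"]) (auto simp: hd_rev last_rev)
qed

lemma reachable_trans:
  assumes "reachable G u v" "reachable G v w"
  shows "reachable G u w"
proof -
  obtain p q where p: "walk G p" "hd p = u" "last p = v"
    and q: "walk G q" "hd q = v" "last q = w"
    using assms by (auto simp: reachable_def)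
  \<comment> \<open>Both walks contain the joint \<open>v\<close>; it is dropped from the second
    one, so that the concatenation has no step from \<open>v\<close> to itself.\<close>
  obtain q' where q': "q = v # q'"
    using q by (cases q) (auto simp: walk_def)
  have "walk G (p @ q')"
    using p q q' by (auto simp: walk_def successively_append_iff successively_Cons)
  moreover have "hd (p @ q') = u" "last (p @ q') = w"
    using p q q' by (auto simp: walk_def)
  ultimately show ?thesis
    unfolding reachable_def by blast
qed

text \<open>Each step of a walk in \<open>G\<close> is replaced by a walk in \<open>H\<close>, and
  the pieces are chained by transitivity. This permits a detour around a deleted edge.\<close>

lemma reachable_mono_edges:
  assumes "reachable G u v" "verts G = verts H"
    and edge: "\<And>a b. a \<in> verts G \<Longrightarrow> b \<in> verts G \<Longrightarrow> {a, b} \<in> edges G \<Longrightarrow> reachable H a b"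
  shows "reachable H u v"
proof -
  have "walk G p \<Longrightarrow> reachable H (hd p) (last p)" for p
  proof (induction p)
    case Nil
    then show ?case by (simp add: walk_def)
  next
    case (Cons a p)
    show ?case
    proof (cases p)
      case Nil
      then show ?thesis
        using Cons.prems assms(2) by (auto simp: walk_def intro: reachable_refl)
    next
      case (Cons b q)
      then have "walk G p" "reachable H a b"
        using Cons.prems by (auto simp: walk_def intro: edge)
      then show ?thesis
        using Cons.IH Cons by (auto intro: reachable_trans)
    qed
  qed
  then show ?thesis
    using assms(1) by (auto simp: reachable_def)
qed

text \<open>Between two occurrences of a repeated vertex the walk makes a closed excursion. Cutting
  it out keeps both ends and shortens the walk, so induction on the length applies.\<close>

lemma reachable_imp_distinct_walk:
  assumes "reachable G u v"
  obtains p where "walk G p" "distinct p" "hd p = u" "last p = v"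
proof -
  have "\<exists>q. walk G q \<and> distinct q \<and> hd q = hd p \<and> last q = last p" if "walk G p" for p
    using that
  proof (induction "length p" arbitrary: p rule: less_induct)
    case less
    show ?case
    proof (cases "distinct p")
      case False
      then obtain xs ys zs y where p: "p = xs @ [y] @ ys @ [y] @ zs"
        using not_distinct_decomp by blast
      have "walk G (xs @ [y] @ zs)"
        using less.prems p by (auto simp: walk_def successively_append_iff successively_Cons)
      moreover have "length (xs @ [y] @ zs) < length p"
        using p by simp
      moreover have "hd (xs @ [y] @ zs) = hd p" "last (xs @ [y] @ zs) = last p"
        using p by (auto simp: hd_append)
      ultimately show ?thesis
        using less.hyps by metis
    qed (use less.prems in blast)
  qed
  then show thesis
    using assms that unfolding reachable_def by metis
qed

section \<open>Edge sets of cycles given by vertex lists\<close>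

lemma cycle_edges_image:
  "cycle_edges p = (\<lambda>i. {p ! i, p ! (Suc i mod length p)}) ` {..<length p}"
  unfolding cycle_edges_def lessThan_def by (rule setcompr_eq_image)

text \<open>Only the last index \<open>length p - 1\<close> wraps around under \<open>mod\<close>;
  splitting it off leaves the path along \<open>p\<close> and one closing edge.\<close>

lemma cycle_edges_closed_path:
  assumes "p \<noteq> []"
  shows "cycle_edges p = insert {last p, hd p} {{p ! i, p ! Suc i} | i. Suc i < length p}"
proof -
  have "{..<length p} = insert (length p - 1) {i. Suc i < length p}"
    using assms by (cases p) auto
  then have "cycle_edges p = (\<lambda>i. {p ! i, p ! (Suc i mod length p)}) `
      insert (length p - 1) {i. Suc i < length p}"
    by (simp only: cycle_edges_image)
  also have "\<dots> = insert {last p, hd p} ((\<lambda>i. {p ! i, p ! (Suc i mod length p)}) ` {i. Suc i < length p})"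
    using assms by (simp add: last_conv_nth hd_conv_nth)
  also have "(\<lambda>i. {p ! i, p ! (Suc i mod length p)}) ` {i. Suc i < length p}
      = {{p ! i, p ! Suc i} | i. Suc i < length p}"
    by (auto simp: image_def)
  finally show ?thesis .
qed

text \<open>Rotating by one composes the indexing of the edges with the cyclic shift of the indices,
  which permutes them. Thus any edge can be moved to the closing position.\<close>

lemma cycle_edges_rotate: "cycle_edges (rotate k p) = cycle_edges p"
proof -
  have "cycle_edges (rotate1 q) = cycle_edges q" for q :: "'a list"
  proof (cases "q = []")
    case False
    let ?n = "length q" and ?f = "\<lambda>i. {q ! i, q ! (Suc i mod length q)}"
    have "rotate1 q ! i = q ! (Suc i mod ?n)" if "i < ?n" for i
      using that nth_rotate[of i q 1] by simp
    then have "cycle_edges (rotate1 q) = ?f ` (\<lambda>i. Suc i mod ?n) ` {..<?n}"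
      using False unfolding cycle_edges_image image_image length_rotate1
      by (intro image_cong) simp_all
    moreover have "(\<lambda>i. Suc i mod ?n) ` {..<?n} = {..<?n}"
    proof
      show "{..<?n} \<subseteq> (\<lambda>i. Suc i mod ?n) ` {..<?n}"
      proof
        fix j assume "j \<in> {..<?n}"
        then show "j \<in> (\<lambda>i. Suc i mod ?n) ` {..<?n}"
          \<comment> \<open>The witness is the cyclic predecessor of \<open>j\<close>; for
            \<open>0\<close> this is the last index.\<close>
          by (cases j) (auto intro!: image_eqI[of _ _ "if j = 0 then ?n - 1 else j - 1"])
      qed
    qed (use False in auto)
    ultimately show ?thesis
      by (simp only: cycle_edges_image)
  qed simp
  then show ?thesis
    by (induction k) simp_all
qed

text \<open>After a rotation that makes \<open>d\<close> the closing edge, the list itself is a path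
  through the remaining edges.\<close>

lemma cycle_minus_edge_path:
  assumes "distinct p" "length p \<ge> 3" "d \<in> cycle_edges p"
  obtains q where "distinct q" "set q = set p" "q \<noteq> []" "d = {last q, hd q}"
    "successively (\<lambda>u v. {u, v} \<in> cycle_edges p - {d}) q"
proof -
  obtain i where i: "i < length p" "d = {p ! i, p ! (Suc i mod length p)}"
    using assms(3) by (auto simp: cycle_edges_def)
  \<comment> \<open>Rotating by \<open>Suc i\<close> puts the second end of \<open>d\<close> first
    and hence \<open>p ! i\<close> last.\<close>
  define q where "q = rotate (Suc i) p"
  have q: "q \<noteq> []" "length q = length p" "set q = set p" "distinct q"
    using assms by (auto simp: q_def simp del: rotate_Suc)
  have hd: "hd q = p ! (Suc i mod length p)"
    using assms q(1) by (simp add: q_def hd_rotate_conv_nth del: rotate_Suc)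
  have "last q = p ! ((Suc i + (length p - 1)) mod length p)"
    using assms q(1) nth_rotate[of "length p - 1" p "Suc i"]
    by (simp add: last_conv_nth q(2)) (simp add: q_def)
  also have "Suc i + (length p - 1) = i + length p"
    using i by simp
  finally have last: "last q = p ! i"
    using i by simp
  have d: "d = {last q, hd q}"
    using i hd last by simp
  have "successively (\<lambda>u v. {u, v} \<in> cycle_edges p - {d}) q"
    unfolding successively_conv_nth
  proof (intro allI impI)
    fix j assume j: "Suc j < length q"
    have "{q ! j, q ! Suc j} \<in> cycle_edges q"
      using j q(1) by (auto simp: cycle_edges_closed_path)
    moreover have "cycle_edges q = cycle_edges p"
      unfolding q_def by (rule cycle_edges_rotate)
    \<comment> \<open>If a step of the path were the closing edge, distinctness would force
      \<open>j = 0\<close> and \<open>Suc j = length q - 1\<close>, that is, a list of length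
      2.\<close>
    moreover have "q ! j \<noteq> q ! (length q - 1)" "q ! j = q ! 0 \<longleftrightarrow> j = 0"
      "q ! Suc j = q ! (length q - 1) \<longleftrightarrow> Suc j = length q - 1"
      using j q by (subst nth_eq_iff_index_eq; force)+
    then have "{q ! j, q ! Suc j} \<noteq> {q ! (length q - 1), q ! 0}"
      using j q(2) assms(2) unfolding doubleton_eq_iff by linarith
    ultimately show "{q ! j, q ! Suc j} \<in> cycle_edges p - {d}"
      using d q(1) by (simp add: last_conv_nth hd_conv_nth)
  qed
  then show thesis
    using that q d by blast
qed

section \<open>Deleting an edge of a cycle, and closing a path to a cycle\<close>

lemma connected_delete_cycle_edge:
  assumes "connected_graph G" "C \<in> cycles G" "d \<in> edges C"
  shows "connected_graph (Graph (verts G) (edges G - {d}))" (is "connected_graph ?H")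
proof -
  obtain p where p: "distinct p" "length p \<ge> 3" "verts C = set p" "edges C = cycle_edges p"
    and sub: "verts C \<subseteq> verts G" "edges C \<subseteq> edges G"
    using assms(2) by (auto simp: cycles_def cycle_graph_def subgraph_def)
  obtain q where q: "q \<noteq> []" "set q = set p" "d = {last q, hd q}"
    "successively (\<lambda>u v. {u, v} \<in> cycle_edges p - {d}) q"
    using cycle_minus_edge_path p assms(3) by metis
  \<comment> \<open>What is left of the cycle is the detour that replaces \<open>d\<close>; all
    other edges survive.\<close>
  have "walk ?H q"
    using q sub p by (auto simp: walk_def elim!: successively_mono)
  then have ends: "reachable ?H (hd q) (last q)"
    unfolding reachable_def by blast
  have "reachable ?H a b" if "a \<in> verts G" "b \<in> verts G" "{a, b} \<in> edges G" for a b
  proof (cases "{a, b} = d")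
    case True
    then show ?thesis
      using q(3) ends reachable_sym by (metis doubleton_eq_iff)
  qed (use that in \<open>auto intro: reachable_edge\<close>)
  then have "reachable ?H u v" if "reachable G u v" for u v
    using that reachable_mono_edges[of G u v ?H] by simp
  then show ?thesis
    using assms(1) by (simp add: connected_graph_iff_reachable)
qed

text \<open>The path in \<open>T\<close> followed by an edge outside \<open>T\<close> is a cycle of
  \<open>G\<close>. The bound on its edges is what later shows that it avoids a given edge missing
  from \<open>T\<close>.\<close>

lemma distinct_walk_closes_to_cycle:
  assumes "simple_graph G" "subgraph T G" "walk T p" "distinct p" "hd p \<noteq> last p"
    and new: "{hd p, last p} \<in> edges G - edges T"
  shows "Graph (set p) (cycle_edges p) \<in> cycles G"
    and "cycle_edges p \<subseteq> insert {hd p, last p} (edges T)"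
proof -
  have ne: "p \<noteq> []"
    using assms(3) by (simp add: walk_def)
  have steps: "\<And>i. Suc i < length p \<Longrightarrow> {p ! i, p ! Suc i} \<in> edges T"
    using assms(3) by (simp add: walk_def successively_conv_nth)
  show sub: "cycle_edges p \<subseteq> insert {hd p, last p} (edges T)"
    using ne steps by (auto simp: cycle_edges_closed_path insert_commute)
  \<comment> \<open>Length 1 would make the ends equal; with length 2 the only step of the walk
    would be the new edge, which is not in \<open>T\<close>.\<close>
  have "length p \<noteq> 1" "length p \<noteq> 2"
    using assms(5) new steps[of 0] ne by (auto simp: hd_conv_nth last_conv_nth)
  then have len: "length p \<ge> 3"
    using ne by (cases "length p") auto
  have subG: "cycle_edges p \<subseteq> edges G"
    using sub new assms(2) by (auto simp: subgraph_def)
  have "\<forall>x\<in>cycle_edges p. x \<subseteq> set p"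
    using ne by (auto simp: cycle_edges_def)
  then have "simple_graph (Graph (set p) (cycle_edges p))"
    using subG assms(1) by (auto simp: simple_graph_def)
  moreover have "set p \<subseteq> verts G"
    using assms(2,3) by (auto simp: walk_def subgraph_def)
  ultimately show "Graph (set p) (cycle_edges p) \<in> cycles G"
    using len assms(4) subG by (auto simp: cycles_def subgraph_def cycle_graph_def)
qed

section \<open>Spanning trees of a graph with a single cycle\<close>

lemma spanning_tree_edge_sets_single_cycle:
  assumes G: "simple_graph G" "connected_graph G" and C: "cycles G = {C}"
  shows "spanning_tree_edge_sets G = {edges G - {d} | d. d \<in> edges C}"
proof (intro subset_antisym subsetI)
  fix F assume "F \<in> spanning_tree_edge_sets G"
  then obtain T where T: "F = edges T" "subgraph T G" "tree T" "verts T = verts G"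
    by (auto simp: spanning_tree_edge_sets_def spanning_tree_def)
  have "C \<notin> cycles T" and "C \<in> cycles G"
    using T(3) C by (auto simp: tree_def)
  \<comment> \<open>As \<open>T\<close> has all vertices of \<open>G\<close>, the cycle
    \<open>C\<close> can fail to be a subgraph of \<open>T\<close> only through a missing
    edge.\<close>
  then obtain d where d: "d \<in> edges C" "d \<notin> edges T"
    using T(4) by (auto simp: cycles_def subgraph_def)
  have "f \<in> edges T" if f: "f \<in> edges G" "f \<noteq> d" for f
  proof (rule ccontr)
    assume nT: "f \<notin> edges T"
    have "card f = 2" and fG: "f \<subseteq> verts G"
      using f(1) G(1) by (simp_all add: simple_graph_def)
    then obtain u v where "f = {u, v}" "u \<noteq> v"
      by (meson card_2_iff)
    with fG have uv: "f = {u, v}" "u \<noteq> v" "u \<in> verts G" "v \<in> verts G"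
      by simp_all
    have "reachable T u v"
      using T(3,4) uv by (simp add: tree_def connected_graph_iff_reachable)
    then obtain p where p: "walk T p" "distinct p" "hd p = u" "last p = v"
      using reachable_imp_distinct_walk by metis
    have "Graph (set p) (cycle_edges p) \<in> cycles G" "cycle_edges p \<subseteq> insert f (edges T)"
      using distinct_walk_closes_to_cycle[OF G(1) T(2) p(1,2)] p uv f nT by auto
    \<comment> \<open>By uniqueness the new cycle is \<open>C\<close>. But \<open>d\<close> lies in
      \<open>C\<close>, differs from \<open>f\<close> and is not in \<open>T\<close>.\<close>
    then have "edges C \<subseteq> insert f (edges T)"
      using C by auto
    then show False
      using d f by auto
  qed
  then have "F = edges G - {d}"
    using T d by (auto simp: subgraph_def)
  then show "F \<in> {edges G - {d} | d. d \<in> edges C}"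
    using d by blast
next
  fix F assume "F \<in> {edges G - {d} | d. d \<in> edges C}"
  then obtain d where d: "d \<in> edges C" "F = edges G - {d}"
    by blast
  define T where "T = Graph (verts G) F"
  have "simple_graph T"
    using G(1) d by (auto simp: T_def simple_graph_def)
  moreover have "connected_graph T"
    using connected_delete_cycle_edge[OF G(2), of C d] C d by (simp add: T_def)
  \<comment> \<open>Cycles of a subgraph are cycles of \<open>G\<close>, and \<open>C\<close> is
    lost with \<open>d\<close>; so none is left.\<close>
  moreover have "cycles T \<subseteq> cycles G - {C}"
    using d by (auto simp: cycles_def subgraph_def T_def)
  ultimately have "spanning_tree T G"
    using d C by (auto simp: spanning_tree_def tree_def subgraph_def T_def)
  then show "F \<in> spanning_tree_edge_sets G"
    unfolding spanning_tree_edge_sets_def T_def by force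
qed

theorem lemma3p1:
  fixes U C :: "'a graph" and n m :: nat and e :: "nat \<Rightarrow> 'a set"
  assumes "unicyclic U n m"
    and "bij_betw e {1..n} (edges U)"
    and "C \<in> cycles U"
    and "e ` {1..m} = edges C"
  shows "(\<forall>F. F \<subseteq> edges U \<longrightarrow>
            (F \<in> spanning_tree_edge_sets U \<longleftrightarrow> (\<exists>i\<in>{1..m}. F = edges U - {e i})))
       \<and> spanning_tree_edge_sets U = {edges U - {e i} | i. 1 \<le> i \<and> i \<le> m}"
proof -
  have "simple_graph U" "connected_graph U" "cycles U = {C}"
    using assms(1,3) by (auto simp: unicyclic_def)
  then have "spanning_tree_edge_sets U = {edges U - {d} | d. d \<in> e ` {1..m}}"
    unfolding assms(4) by (rule spanning_tree_edge_sets_single_cycle)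
  \<comment> \<open>In image form, composing with \<open>e\<close> turns the parameter from cycle
    edges into indices.\<close>
  then have "spanning_tree_edge_sets U = (\<lambda>i. edges U - {e i}) ` {1..m}"
    by (simp only: setcompr_eq_image Collect_mem_eq image_image)
  moreover have "{edges U - {e i} | i. 1 \<le> i \<and> i \<le> m} = (\<lambda>i. edges U - {e i}) ` {1..m}"
    by (simp only: setcompr_eq_image atLeastAtMost_iff[symmetric] Collect_mem_eq)
  ultimately show ?thesis
    by (simp only: image_iff) simp
qed

end
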